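(* Let $n\ge 2$, let $\mathbf A=(A,q,\mathsf e_1,\dots,\mathsf e_n)$ be an $n\mathrm{BA}$ and let $i\in\{1,\dots,n\}$. Then the skew $i$-reduct $S_i(\mathbf A)=(A,\land_i,\overline\vee_i,\setminus_i,\mathsf e_i)$ is a right-handed skew Boolean algebra with bottom element $\mathsf e_i$, and the elements $\mathsf e_1,\dots,\mathsf e_{i-1},\mathsf e_{i+1},\dots,\mathsf e_n$ are maximal elements (with respect to its natural partial order).
   Context: Let $n\ge 2$. An $n\mathrm{BA}$ (Boolean-like algebra of dimension $n$) is an algebra $\mathbf A=(A,q,\mathsf e_1,\dots,\mathsf e_n)$ with $q$ of arity $n+1$ and constants $\mathsf e_1,\dots,\mathsf e_n$ satisfying the identities (B0) $q(\mathsf e_i,x^1,\dots,x^n)=x^i$ for $i=1,\dots,n$; (B1) $q(y,x,\dots,x)=x$; (B2) $q(y,q(y,x^{11},\dots,x^{1n}),\dots,q(y,x^{n1},\dots,x^{nn}))=q(y,x^{11},x^{22},\dots,x^{nn})$; (B3) $q(y,q(x^{10},\dots,x^{1n}),\dots,q(x^{n0},\dots,x^{nn}))=q(q(y,x^{10},\dots,x^{n0}),\dots,q(y,x^{1n},\dots,x^{nn}))$; (B4) $q(y,\mathsf e_1,\dots,\mathsf e_n)=y$. For $i\in\{1,\dots,n\}$ let $t_i(x,y,z)=q(x,w_1,\dots,w_n)$ with $w_i=z$ and $w_k=y$ for $k\ne i$. Define $x\land_i y=t_i(x,y,\mathsf e_i)$, $x\,\overline\vee_i\,y=t_i(x,x,y)$,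 $y\setminus_i x=t_i(x,\mathsf e_i,y)$. A skew lattice is an algebra $(A,\lor,\land)$ with $\lor,\land$ associative and idempotent, satisfying $x\lor(x\land y)=x=x\land(x\lor y)$ and $(y\land x)\lor x=x=(y\lor x)\land x$. A skew Boolean algebra is an algebra $(A,\lor,\land,\setminus,0)$ of type $(2,2,2,0)$ such that: $(A,\lor,\land)$ is a skew lattice satisfying $x\land y\land z\land x=x\land z\land y\land x$, $x\land(y\lor z)=(x\land y)\lor(x\land z)$, $(y\lor z)\land x=(y\land x)\lor(z\land x)$; $0\land x=0=x\land 0$; and $(x\land y\land x)\lor(x\setminus y)=x=(x\setminus y)\lor(x\land y\land x)$, $x\land y\land x\land(x\setminus y)=0=(x\setminus y)\land x\land y\land x$. It is right-handed if $a\land b\land a=b\land a$ for all $a,b$. Its natural partial order is $x\le y$ iff $x\land y=x=y\land x$. In $S_i(\mathbf A)$ the operation $\overline\vee_i$ plays the role of $\lor$, $\land_i$ of $\land$, $\setminus_i$ of $\setminus$, and $\mathsf e_i$ of $0$. *)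

theory Defs
  imports Main "HOL-Library.FuncSet"
begin

text \<open>
  The operation of arity n + 1 takes its last n arguments as a family indexed by 1..n.
  Families are always passed in the form \<open>\<lambda>k\<in>{1..n}. x k\<close>, so values of \<open>x\<close> outside the index
  set are irrelevant. In axiom B3 the entry \<open>x k 0\<close> is the first argument of the k-th inner term.
\<close>

locale nBA =
  fixes n :: nat
    and A :: "'a set"
    and q :: "'a \<Rightarrow> (nat \<Rightarrow> 'a) \<Rightarrow> 'a"
    and e :: "nat \<Rightarrow> 'a"
  assumes q_closed: "\<And>y x. y \<in> A \<Longrightarrow> x \<in> {1..n} \<rightarrow> A \<Longrightarrow> q y (\<lambda>k\<in>{1..n}. x k) \<in> A"
    and e_closed: "\<And>k. k \<in> {1..n} \<Longrightarrow> e k \<in> A"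
    and B0: "\<And>i x. i \<in> {1..n} \<Longrightarrow> x \<in> {1..n} \<rightarrow> A \<Longrightarrow> q (e i) (\<lambda>k\<in>{1..n}. x k) = x i"
    and B1: "\<And>y x. y \<in> A \<Longrightarrow> x \<in> A \<Longrightarrow> q y (\<lambda>k\<in>{1..n}. x) = x"
    and B2: "\<And>y x. y \<in> A \<Longrightarrow> (\<forall>k\<in>{1..n}. \<forall>j\<in>{1..n}. x k j \<in> A) \<Longrightarrow>
      q y (\<lambda>k\<in>{1..n}. q y (\<lambda>j\<in>{1..n}. x k j)) = q y (\<lambda>k\<in>{1..n}. x k k)"
    and B3: "\<And>y x. y \<in> A \<Longrightarrow> (\<forall>k\<in>{1..n}. \<forall>j\<in>{0..n}. x k j \<in> A) \<Longrightarrow>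
      q y (\<lambda>k\<in>{1..n}. q (x k 0) (\<lambda>j\<in>{1..n}. x k j)) =
      q (q y (\<lambda>k\<in>{1..n}. x k 0)) (\<lambda>j\<in>{1..n}. q y (\<lambda>k\<in>{1..n}. x k j))"
    and B4: "\<And>y. y \<in> A \<Longrightarrow> q y (\<lambda>k\<in>{1..n}. e k) = y"

definition nBA_t :: "nat \<Rightarrow> ('a \<Rightarrow> (nat \<Rightarrow> 'a) \<Rightarrow> 'a) \<Rightarrow> nat \<Rightarrow> 'a \<Rightarrow> 'a \<Rightarrow> 'a \<Rightarrow> 'a"
  where "nBA_t n q i x y z = q x (\<lambda>k\<in>{1..n}. if k = i then z else y)"

definition nBA_meet ::
    "nat \<Rightarrow> ('a \<Rightarrow> (nat \<Rightarrow> 'a) \<Rightarrow> 'a) \<Rightarrow> (nat \<Rightarrow> 'a) \<Rightarrow> nat \<Rightarrow> 'a \<Rightarrow> 'a \<Rightarrow> 'a"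
  where "nBA_meet n q e i x y = nBA_t n q i x y (e i)"

definition nBA_join :: "nat \<Rightarrow> ('a \<Rightarrow> (nat \<Rightarrow> 'a) \<Rightarrow> 'a) \<Rightarrow> nat \<Rightarrow> 'a \<Rightarrow> 'a \<Rightarrow> 'a"
  where "nBA_join n q i x y = nBA_t n q i x x y"

definition nBA_diff ::
    "nat \<Rightarrow> ('a \<Rightarrow> (nat \<Rightarrow> 'a) \<Rightarrow> 'a) \<Rightarrow> (nat \<Rightarrow> 'a) \<Rightarrow> nat \<Rightarrow> 'a \<Rightarrow> 'a \<Rightarrow> 'a"
  where "nBA_diff n q e i y x = nBA_t n q i x (e i) y"

locale skew_lattice =
  fixes A :: "'a set"
    and join :: "'a \<Rightarrow> 'a \<Rightarrow> 'a" (infixl "\<squnion>" 65)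
    and meet :: "'a \<Rightarrow> 'a \<Rightarrow> 'a" (infixl "\<sqinter>" 70)
  assumes join_closed: "\<And>x y. x \<in> A \<Longrightarrow> y \<in> A \<Longrightarrow> x \<squnion> y \<in> A"
    and meet_closed: "\<And>x y. x \<in> A \<Longrightarrow> y \<in> A \<Longrightarrow> x \<sqinter> y \<in> A"
    and join_assoc: "\<And>x y z. x \<in> A \<Longrightarrow> y \<in> A \<Longrightarrow> z \<in> A \<Longrightarrow> (x \<squnion> y) \<squnion> z = x \<squnion> (y \<squnion> z)"
    and meet_assoc: "\<And>x y z. x \<in> A \<Longrightarrow> y \<in> A \<Longrightarrow> z \<in> A \<Longrightarrow> (x \<sqinter> y) \<sqinter> z = x \<sqinter> (y \<sqinter> z)"
    and join_idem: "\<And>x. x \<in> A \<Longrightarrow> x \<squnion> x = x"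
    and meet_idem: "\<And>x. x \<in> A \<Longrightarrow> x \<sqinter> x = x"
    and absorb1: "\<And>x y. x \<in> A \<Longrightarrow> y \<in> A \<Longrightarrow> x \<squnion> (x \<sqinter> y) = x"
    and absorb2: "\<And>x y. x \<in> A \<Longrightarrow> y \<in> A \<Longrightarrow> x \<sqinter> (x \<squnion> y) = x"
    and absorb3: "\<And>x y. x \<in> A \<Longrightarrow> y \<in> A \<Longrightarrow> (y \<sqinter> x) \<squnion> x = x"
    and absorb4: "\<And>x y. x \<in> A \<Longrightarrow> y \<in> A \<Longrightarrow> (y \<squnion> x) \<sqinter> x = x"

locale skew_boolean_algebra = skew_lattice A join meet
  for A :: "'a set"
    and join :: "'a \<Rightarrow> 'a \<Rightarrow> 'a" (infixl "\<squnion>" 65)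
    and meet :: "'a \<Rightarrow> 'a \<Rightarrow> 'a" (infixl "\<sqinter>" 70) +
  fixes diff :: "'a \<Rightarrow> 'a \<Rightarrow> 'a" (infixl "\<ominus>" 65)
    and zero :: "'a" ("\<zero>")
  assumes diff_closed: "\<And>x y. x \<in> A \<Longrightarrow> y \<in> A \<Longrightarrow> x \<ominus> y \<in> A"
    and zero_closed: "\<zero> \<in> A"
    and normal: "\<And>x y z. x \<in> A \<Longrightarrow> y \<in> A \<Longrightarrow> z \<in> A \<Longrightarrow> x \<sqinter> y \<sqinter> z \<sqinter> x = x \<sqinter> z \<sqinter> y \<sqinter> x"
    and distrib_left: "\<And>x y z. x \<in> A \<Longrightarrow> y \<in> A \<Longrightarrow> z \<in> A \<Longrightarrow> x \<sqinter> (y \<squnion> z) = (x \<sqinter> y) \<squnion> (x \<sqinter> z)"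
    and distrib_right: "\<And>x y z. x \<in> A \<Longrightarrow> y \<in> A \<Longrightarrow> z \<in> A \<Longrightarrow> (y \<squnion> z) \<sqinter> x = (y \<sqinter> x) \<squnion> (z \<sqinter> x)"
    and zero_meet: "\<And>x. x \<in> A \<Longrightarrow> \<zero> \<sqinter> x = \<zero>"
    and meet_zero: "\<And>x. x \<in> A \<Longrightarrow> x \<sqinter> \<zero> = \<zero>"
    and meet_join_diff: "\<And>x y. x \<in> A \<Longrightarrow> y \<in> A \<Longrightarrow> (x \<sqinter> y \<sqinter> x) \<squnion> (x \<ominus> y) = x"
    and diff_join_meet: "\<And>x y. x \<in> A \<Longrightarrow> y \<in> A \<Longrightarrow> (x \<ominus> y) \<squnion> (x \<sqinter> y \<sqinter> x) = x"
    and meet_meet_diff: "\<And>x y. x \<in> A \<Longrightarrow> y \<in> A \<Longrightarrow> x \<sqinter> y \<sqinter> x \<sqinter> (x \<ominus> y) = \<zero>"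
    and diff_meet_meet: "\<And>x y. x \<in> A \<Longrightarrow> y \<in> A \<Longrightarrow> (x \<ominus> y) \<sqinter> x \<sqinter> y \<sqinter> x = \<zero>"

locale right_handed_skew_boolean_algebra = skew_boolean_algebra A join meet diff zero
  for A :: "'a set"
    and join :: "'a \<Rightarrow> 'a \<Rightarrow> 'a" (infixl "\<squnion>" 65)
    and meet :: "'a \<Rightarrow> 'a \<Rightarrow> 'a" (infixl "\<sqinter>" 70)
    and diff :: "'a \<Rightarrow> 'a \<Rightarrow> 'a" (infixl "\<ominus>" 65)
    and zero :: "'a" ("\<zero>") +
  assumes right_handed: "\<And>a b. a \<in> A \<Longrightarrow> b \<in> A \<Longrightarrow> a \<sqinter> b \<sqinter> a = b \<sqinter> a"

definition natural_le :: "('a \<Rightarrow> 'a \<Rightarrow> 'a) \<Rightarrow> 'a \<Rightarrow> 'a \<Rightarrow> bool"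
  where "natural_le meet x y \<longleftrightarrow> meet x y = x \<and> x = meet y x"

definition is_bottom :: "'a set \<Rightarrow> ('a \<Rightarrow> 'a \<Rightarrow> bool) \<Rightarrow> 'a \<Rightarrow> bool"
  where "is_bottom A le b \<longleftrightarrow> b \<in> A \<and> (\<forall>x\<in>A. le b x)"

definition is_maximal :: "'a set \<Rightarrow> ('a \<Rightarrow> 'a \<Rightarrow> bool) \<Rightarrow> 'a \<Rightarrow> bool"
  where "is_maximal A le m \<longleftrightarrow> m \<in> A \<and> (\<forall>x\<in>A. le m x \<longrightarrow> x = m)"

end

theory Submission
  imports Defs
begin

text \<open>
  The proof needs only the ternary operation \<open>t = t\<^sub>i\<close>, read as "if the first argument is \<open>e\<^sub>i\<close> then
  the third, else the second". B1 and B2 say that each \<open>t x\<close> is a decomposition operation,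
  B3 says that these operations are homomorphisms of \<open>t\<close>, and B4 yields \<open>t x x e\<^sub>i = x\<close>.
  Hence nested conditions can be flattened and tests permuted as for if-then-else expressions,
  and each axiom of skew Boolean algebras becomes a short rewriting exercise. Maximality of \<open>e\<^sub>j\<close>
  is immediate, because \<open>e\<^sub>j \<and>\<^sub>i x = x\<close> for \<open>j \<noteq> i\<close>.
\<close>

locale nBA_index = nBA n A q e
  for n :: nat and A :: "'a set" and q :: "'a \<Rightarrow> (nat \<Rightarrow> 'a) \<Rightarrow> 'a" and e :: "nat \<Rightarrow> 'a" +
  fixes i :: nat
  assumes index: "i \<in> {1..n}"
begin

abbreviation "t \<equiv> nBA_t n q i"
abbreviation "ei \<equiv> e i"

lemma zero_in [simp]: "ei \<in> A"
  using index by (rule e_closed)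

lemma t_closed [simp]: "x \<in> A \<Longrightarrow> a \<in> A \<Longrightarrow> b \<in> A \<Longrightarrow> t x a b \<in> A"
  unfolding nBA_t_def by (rule q_closed) auto

lemma t_const [simp]: "x \<in> A \<Longrightarrow> a \<in> A \<Longrightarrow> t x a a = a"
  unfolding nBA_t_def by (simp add: B1 del: One_nat_def)

lemma t_e: "j \<in> {1..n} \<Longrightarrow> a \<in> A \<Longrightarrow> b \<in> A \<Longrightarrow> t (e j) a b = (if j = i then b else a)"
  unfolding nBA_t_def by (subst B0) auto

lemma t_zero [simp]: "a \<in> A \<Longrightarrow> b \<in> A \<Longrightarrow> t ei a b = b"
  using t_e[OF index] by simp

text \<open>B2 for a matrix whose entries depend only on whether \<open>k = i\<close> and
  \<open>j = i\<close>: its diagonal is \<open>d\<close> at position \<open>i\<close> and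
  \<open>a\<close> elsewhere.\<close>

lemma t_diag:
  assumes "x \<in> A" "a \<in> A" "b \<in> A" "c \<in> A" "d \<in> A"
  shows "t x (t x a b) (t x c d) = t x a d"
proof -
  define f where
    "f k j = (if k = i then if j = i then d else c else if j = i then b else a)" for k j :: nat
  have "q x (\<lambda>k\<in>{1..n}. q x (\<lambda>j\<in>{1..n}. f k j)) = q x (\<lambda>k\<in>{1..n}. f k k)"
    by (rule B2) (use assms in \<open>auto simp: f_def\<close>)
  moreover have "q x (\<lambda>j\<in>{1..n}. f k j) = (if k = i then t x c d else t x a b)" for k
    by (simp add: f_def nBA_t_def)
  moreover have "f k k = (if k = i then d else a)" for k
    by (simp add: f_def)
  ultimately show ?thesis
    by (simp only: nBA_t_def[of n q i x "t x a b"] nBA_t_def[of n q i x a d])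
qed

lemma t_left_left [simp]:
  assumes "x \<in> A" "a \<in> A" "b \<in> A" "c \<in> A"
  shows "t x (t x a b) c = t x a c"
  using t_diag[of x a b c c] assms by simp

lemma t_right_right [simp]:
  assumes "x \<in> A" "a \<in> A" "b \<in> A" "c \<in> A"
  shows "t x a (t x b c) = t x a c"
  using t_diag[of x a a b c] assms by simp

text \<open>B3 for the same kind of matrix; column 0 holds the inner tests \<open>a1\<close>,
  \<open>a2\<close>.\<close>

lemma t_interchange:
  assumes "x \<in> A" "a1 \<in> A" "b1 \<in> A" "c1 \<in> A" "a2 \<in> A" "b2 \<in> A" "c2 \<in> A"
  shows "t x (t a1 b1 c1) (t a2 b2 c2) = t (t x a1 a2) (t x b1 b2) (t x c1 c2)"
proof -
  define f where
    "f k j = (if j = 0 then if k = i then a2 else a1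
              else if j = i then if k = i then c2 else c1
              else if k = i then b2 else b1)" for k j :: nat
  have "q x (\<lambda>k\<in>{1..n}. q (f k 0) (\<lambda>j\<in>{1..n}. f k j)) =
      q (q x (\<lambda>k\<in>{1..n}. f k 0)) (\<lambda>j\<in>{1..n}. q x (\<lambda>k\<in>{1..n}. f k j))"
    by (rule B3) (use assms in \<open>auto simp: f_def\<close>)
  moreover have "(\<lambda>j\<in>{1..n}. f k j) =
      (\<lambda>j\<in>{1..n}. if j = i then if k = i then c2 else c1 else if k = i then b2 else b1)" for k
    by (rule restrict_ext) (auto simp: f_def)
  then have "q (f k 0) (\<lambda>j\<in>{1..n}. f k j) = (if k = i then t a2 b2 c2 else t a1 b1 c1)" for k
    by (simp add: f_def[of k 0] nBA_t_def)
  moreover have "q x (\<lambda>k\<in>{1..n}. f k 0) = t x a1 a2"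
    by (simp add: f_def nBA_t_def)
  moreover have "(\<lambda>j\<in>{1..n}. q x (\<lambda>k\<in>{1..n}. f k j)) =
      (\<lambda>j\<in>{1..n}. if j = i then t x c1 c2 else t x b1 b2)"
    by (rule restrict_ext) (auto simp: f_def nBA_t_def)
  ultimately show ?thesis
    by (simp only: nBA_t_def[of n q i x "t a1 b1 c1"] nBA_t_def[of n q i "t x a1 a2"])
qed

lemma t_self_zero [simp]:
  assumes "x \<in> A"
  shows "t x x ei = x"
proof -
  \<comment> \<open>Row \<open>i\<close> is constantly \<open>ei\<close> and collapses by B1; every
    other row is \<open>e\<close> and gives \<open>x\<close> by B4. The diagonal is \<open>e\<close>
    again.\<close>
  have "q x (\<lambda>k\<in>{1..n}. q x (\<lambda>j\<in>{1..n}. if k = i then ei else e j)) =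
      q x (\<lambda>k\<in>{1..n}. if k = i then ei else e k)"
    by (rule B2) (use assms e_closed in auto)
  moreover have "q x (\<lambda>j\<in>{1..n}. if k = i then ei else e j) = (if k = i then ei else x)" for k
    using assms by (simp add: B1 B4 del: One_nat_def)
  moreover have "(\<lambda>k. if k = i then ei else e k) = e"
    by auto
  ultimately show ?thesis
    using assms by (simp add: nBA_t_def B4 del: One_nat_def)
qed

text \<open>Interchange with shared branches, which the test \<open>x\<close> leaves fixed: a
  compound test flattens into nested ones.\<close>

lemma t_compose:
  assumes "x \<in> A" "y \<in> A" "y' \<in> A" "a \<in> A" "b \<in> A"
  shows "t (t x y y') a b = t x (t y a b) (t y' a b)"
  using t_interchange[of x y a b y' a b] assms by simp

lemma t_commute:
  assumes "x \<in> A" "y \<in> A" "a \<in> A" "b \<in> A" "c \<in> A" "d \<in> A"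
  shows "t x (t y a b) (t y c d) = t y (t x a c) (t x b d)"
  using t_interchange[of x y a b y c d] assms by simp

lemma t_commute_zero:
  assumes "x \<in> A" "y \<in> A" "a \<in> A"
  shows "t x (t y a ei) ei = t y (t x a ei) ei"
  using t_commute[of x y a ei ei ei] assms by simp

text \<open>Writing the first branch \<open>x\<close> as \<open>t y x x\<close> allows the tests to
  be exchanged; both branches then reduce to \<open>x\<close>.\<close>

lemma t_join_restrict [simp]:
  assumes "x \<in> A" "y \<in> A"
  shows "t x x (t y x ei) = x" and "t x x (t y ei x) = x"
  using t_commute[of x y x x x ei] t_commute[of x y x x ei x] assms by simp_all

text \<open>Within a branch of \<open>x\<close> a repeated test of \<open>x\<close> is already
  decided: lifted over \<open>y\<close>, it meets the outer one and loses its dead branch.\<close>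

lemma t_cofactor_right [simp]:
  assumes "x \<in> A" "y \<in> A" "a \<in> A" "b \<in> A" "c \<in> A" "d \<in> A"
  shows "t x c (t y (t x a b) d) = t x c (t y b d)"
proof -
  have "t y (t x a b) d = t x (t y a d) (t y b d)"
    using t_commute[of y x a b d d] assms by simp
  then show ?thesis
    using assms by simp
qed

lemma t_cofactor_left [simp]:
  assumes "x \<in> A" "y \<in> A" "a \<in> A" "b \<in> A" "c \<in> A" "d \<in> A"
  shows "t x (t y (t x a b) d) c = t x (t y a d) c"
proof -
  have "t y (t x a b) d = t x (t y a d) (t y b d)"
    using t_commute[of y x a b d d] assms by simp
  then show ?thesis
    using assms by simp
qed

text \<open>This is right-handedness: flatten, exchange the tests, and collapse
  \<open>t x x ei\<close>.\<close>

lemma meet_restrict: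
  assumes "x \<in> A" "y \<in> A"
  shows "t (t x y ei) x ei = t y x ei"
  using assms by (simp add: t_compose t_commute_zero[of x y])

lemma right_handed_skew_boolean:
  "right_handed_skew_boolean_algebra A (nBA_join n q i) (nBA_meet n q e i) (nBA_diff n q e i) ei"
  unfolding nBA_join_def nBA_meet_def nBA_diff_def
proof (unfold_locales, goal_cases)
  \<comment> \<open>Normality: both sides flatten to nested tests with \<open>ei\<close> as second
    branch, differing in the order of \<open>y\<close> and \<open>u\<close>.\<close>
  case (13 x y u)
  then show ?case by (simp add: meet_restrict t_compose t_commute_zero[of y u])
next
  \<comment> \<open>Left distributivity is an interchange, with the branch \<open>ei\<close> read as
    \<open>t ei ei ei\<close>.\<close>
  case (14 x y u)
  then show ?case using t_interchange[of x y y u ei ei ei] by simp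
next
  case (22 x y)
  then show ?case by (simp add: meet_restrict)
qed (auto simp: t_compose)

end

theorem corollary4p5:
  fixes n i :: nat
    and A :: "'a set"
    and q :: "'a \<Rightarrow> (nat \<Rightarrow> 'a) \<Rightarrow> 'a"
    and e :: "nat \<Rightarrow> 'a"
  assumes "n \<ge> 2"
    and "nBA n A q e"
    and "i \<in> {1..n}"
  shows "right_handed_skew_boolean_algebra A
           (nBA_join n q i) (nBA_meet n q e i) (nBA_diff n q e i) (e i)
       \<and> is_bottom A (natural_le (nBA_meet n q e i)) (e i)
       \<and> (\<forall>j\<in>{1..n} - {i}. is_maximal A (natural_le (nBA_meet n q e i)) (e j))"
proof -
  interpret nBA_index n A q e i
    using assms(2,3) by (simp add: nBA_index_def nBA_index_axioms_def)
  have "is_bottom A (natural_le (nBA_meet n q e i)) (e i)"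
    by (simp add: is_bottom_def natural_le_def nBA_meet_def)
  moreover have "is_maximal A (natural_le (nBA_meet n q e i)) (e j)" if "j \<in> {1..n} - {i}" for j
    using that e_closed by (auto simp: is_maximal_def natural_le_def nBA_meet_def t_e)
  ultimately show ?thesis
    using right_handed_skew_boolean by blast
qed

end
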